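(* Let $\mathit{Atm}_0$ be finite. Then checking satisfiability of $\mathcal{L}$-formulas relative to the class $\mathbf{MCM}$ can be done in polynomial time (in the size of the formula).
   Context: Let $\mathit{Atm}_0$ be a set of atomic propositions and $\mathit{Val}$ a finite set of output values; decision atoms $\mathsf{t}(x)$ for $x\in\mathit{Val}$. Language $\mathcal{L}$: $\varphi ::= p \mid \mathsf{t}(x)\mid \neg\varphi\mid \varphi\wedge\varphi\mid \Box_{\mathtt{I}}\varphi\mid \Box_{\mathtt{F}}\varphi$ ($p\in\mathit{Atm}_0$, $x\in\mathit{Val}$). A multi-classifier model (MCM) is a pair $\Gamma=(S,\Phi)$ with $S\subseteq 2^{\mathit{Atm}_0}$ and $\Phi$ a set of functions from $S$ to $\mathit{Val}$. For $s\in S$, $f\in\Phi$: $(\Gamma,s,f)\models p$ iff $p\in s$; $(\Gamma,s,f)\models\mathsf{t}(x)$ iff $f(s)=x$; Boolean connectives as usual; $(\Gamma,s,f)\models\Box_{\mathtt{I}}\varphi$ iff $(\Gamma,s',f)\models\varphi$ for all $s'\in S$; $(\Gamma,s,f)\models\Box_{\mathtt{F}}\varphi$ iff $(\Gamma,s,f')\models\varphi$ for all $f'\in\Phi$. $\varphi$ is satisfiable relative to $\mathbf{MCM}$ if it is true at some $(\Gamma,s,f)$ with $s\in S$, $f\in\Phi$. *)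

theory Defs
  imports "HOL-Library.FuncSet" "HOL-Computational_Algebra.Polynomial"
begin

datatype (props: 'p, vals: 'v) fm =
    Prop 'p
  | Dec 'v
  | Neg "('p, 'v) fm"
  | Conj "('p, 'v) fm" "('p, 'v) fm"
  | BoxI "('p, 'v) fm"
  | BoxF "('p, 'v) fm"

definition formulas :: "'p set \<Rightarrow> 'v set \<Rightarrow> ('p, 'v) fm set" where
  "formulas Atm0 Val = {\<phi>. props \<phi> \<subseteq> Atm0 \<and> vals \<phi> \<subseteq> Val}"

type_synonym ('p, 'v) classifier = "'p set \<Rightarrow> 'v"
type_synonym ('p, 'v) model = "'p set set \<times> ('p, 'v) classifier set"

text \<open>Functions from \<open>S\<close> to \<open>Val\<close> are represented extensionally, so that two classifiers
  that agree on \<open>S\<close> are equal.\<close>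

definition MCM :: "'p set \<Rightarrow> 'v set \<Rightarrow> ('p, 'v) model set" where
  "MCM Atm0 Val = {(S, \<Phi>). S \<subseteq> Pow Atm0 \<and> \<Phi> \<subseteq> (S \<rightarrow>\<^sub>E Val)}"

primrec holds :: "('p, 'v) model \<Rightarrow> 'p set \<Rightarrow> ('p, 'v) classifier \<Rightarrow> ('p, 'v) fm \<Rightarrow> bool" where
  "holds \<Gamma> s f (Prop p) \<longleftrightarrow> p \<in> s"
| "holds \<Gamma> s f (Dec x) \<longleftrightarrow> f s = x"
| "holds \<Gamma> s f (Neg \<phi>) \<longleftrightarrow> \<not> holds \<Gamma> s f \<phi>"
| "holds \<Gamma> s f (Conj \<phi> \<psi>) \<longleftrightarrow> holds \<Gamma> s f \<phi> \<and> holds \<Gamma> s f \<psi>"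
| "holds \<Gamma> s f (BoxI \<phi>) \<longleftrightarrow> (\<forall>s'\<in>fst \<Gamma>. holds \<Gamma> s' f \<phi>)"
| "holds \<Gamma> s f (BoxF \<phi>) \<longleftrightarrow> (\<forall>f'\<in>snd \<Gamma>. holds \<Gamma> s f' \<phi>)"

definition satisfiable :: "'p set \<Rightarrow> 'v set \<Rightarrow> ('p, 'v) fm \<Rightarrow> bool" where
  "satisfiable Atm0 Val \<phi> \<longleftrightarrow>
     (\<exists>\<Gamma>\<in>MCM Atm0 Val. \<exists>s\<in>fst \<Gamma>. \<exists>f\<in>snd \<Gamma>. holds \<Gamma> s f \<phi>)"

text \<open>Formulas are presented to a machine in Polish (prefix) notation. Every atom is a single
  letter, so the alphabet is finite iff \<open>Atm0\<close> and \<open>Val\<close> are, and the length of the string is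
  the number of symbols in the formula.\<close>

datatype ('p, 'v) letter = LProp 'p | LDec 'v | LNeg | LConj | LBoxI | LBoxF

definition letters :: "'p set \<Rightarrow> 'v set \<Rightarrow> ('p, 'v) letter set" where
  "letters Atm0 Val = LProp ` Atm0 \<union> LDec ` Val \<union> {LNeg, LConj, LBoxI, LBoxF}"

primrec polish :: "('p, 'v) fm \<Rightarrow> ('p, 'v) letter list" where
  "polish (Prop p) = [LProp p]"
| "polish (Dec x) = [LDec x]"
| "polish (Neg \<phi>) = LNeg # polish \<phi>"
| "polish (Conj \<phi> \<psi>) = LConj # polish \<phi> @ polish \<psi>"
| "polish (BoxI \<phi>) = LBoxI # polish \<phi>"
| "polish (BoxF \<phi>) = LBoxF # polish \<phi>"

primrec fm_size :: "('p, 'v) fm \<Rightarrow> nat" where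
  "fm_size (Prop p) = 1"
| "fm_size (Dec x) = 1"
| "fm_size (Neg \<phi>) = 1 + fm_size \<phi>"
| "fm_size (Conj \<phi> \<psi>) = 1 + fm_size \<phi> + fm_size \<psi>"
| "fm_size (BoxI \<phi>) = 1 + fm_size \<phi>"
| "fm_size (BoxF \<phi>) = 1 + fm_size \<phi>"

lemma length_polish: "length (polish \<phi>) = fm_size \<phi>"
  by (induction \<phi>) auto

lemma polish_in_lists: "\<phi> \<in> formulas Atm0 Val \<Longrightarrow> polish \<phi> \<in> lists (letters Atm0 Val)"
  by (induction \<phi>) (auto simp: formulas_def letters_def)

lemma polish_append_inject: "polish \<phi> @ u = polish \<psi> @ v \<Longrightarrow> \<phi> = \<psi> \<and> u = v"
proof (induction \<phi> arbitrary: \<psi> u v)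
  case (Prop p)
  then show ?case by (cases \<psi>) auto
next
  case (Dec x)
  then show ?case by (cases \<psi>) auto
next
  case (Neg \<phi>)
  then show ?case by (cases \<psi>) auto
next
  case (Conj \<phi>1 \<phi>2)
  from Conj.prems obtain \<psi>1 \<psi>2 where \<psi>: "\<psi> = Conj \<psi>1 \<psi>2"
    and eq: "polish \<phi>1 @ (polish \<phi>2 @ u) = polish \<psi>1 @ (polish \<psi>2 @ v)"
    by (cases \<psi>) auto
  from Conj.IH(1)[OF eq] Conj.IH(2) \<psi> show ?case by blast
next
  case (BoxI \<phi>)
  then show ?case by (cases \<psi>) auto
next
  case (BoxF \<phi>)
  then show ?case by (cases \<psi>) auto
qed

lemma inj_polish: "inj polish"
  using polish_append_inject[of _ "[]" _ "[]"] by (auto intro: injI)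

definition SAT :: "'p set \<Rightarrow> 'v set \<Rightarrow> ('p, 'v) letter list set" where
  "SAT Atm0 Val = polish ` {\<phi> \<in> formulas Atm0 Val. satisfiable Atm0 Val \<phi>}"

text \<open>States and auxiliary tape symbols are natural numbers. As both the state set and the tape
  alphabet of a machine are finite, this is no restriction.\<close>

datatype 'a tape_sym = Blank | Inp 'a | Aux nat

datatype move = Left | Right | Stay

record 'a tm =
  ntapes :: nat
  states :: "nat set"
  tape_syms :: "'a tape_sym set"
  start :: nat
  accept :: nat
  reject :: nat
  delta :: "nat \<Rightarrow> 'a tape_sym list \<Rightarrow> nat \<times> ('a tape_sym \<times> move) list"

text \<open>The finite transition table of a machine is \<open>delta\<close> restricted to its states and to
  \<open>ntapes\<close>-tuples of its tape symbols. The last condition keeps every computation within that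
  finite domain, so values of \<open>delta\<close> elsewhere are irrelevant.\<close>

definition turing_machine :: "'a set \<Rightarrow> 'a tm \<Rightarrow> bool" where
  "turing_machine \<Sigma> M \<longleftrightarrow>
     ntapes M \<ge> 1 \<and>
     finite (states M) \<and> {start M, accept M, reject M} \<subseteq> states M \<and> accept M \<noteq> reject M \<and>
     finite (tape_syms M) \<and> Blank \<in> tape_syms M \<and> Inp ` \<Sigma> \<subseteq> tape_syms M \<and>
     (\<forall>q\<in>states M. \<forall>rs\<in>lists (tape_syms M). length rs = ntapes M \<longrightarrow>
        fst (delta M q rs) \<in> states M \<and>
        length (snd (delta M q rs)) = ntapes M \<and>
        fst ` set (snd (delta M q rs)) \<subseteq> tape_syms M)"

text \<open>A tape is a head position together with the contents of a two-way infinite sequence of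
  cells.\<close>

type_synonym 'a tape = "int \<times> (int \<Rightarrow> 'a tape_sym)"
type_synonym 'a config = "nat \<times> 'a tape list"

definition read :: "'a tape \<Rightarrow> 'a tape_sym" where
  "read t = snd t (fst t)"

primrec shift :: "move \<Rightarrow> int" where
  "shift Left = -1"
| "shift Right = 1"
| "shift Stay = 0"

definition act :: "'a tape_sym \<times> move \<Rightarrow> 'a tape \<Rightarrow> 'a tape" where
  "act a t = (fst t + shift (snd a), (snd t)(fst t := fst a))"

definition step :: "'a tm \<Rightarrow> 'a config \<Rightarrow> 'a config" where
  "step M c =
     (if fst c \<in> {accept M, reject M} then c
      else let (q, as) = delta M (fst c) (map read (snd c)) in (q, map2 act as (snd c)))"

definition input_tape :: "'a list \<Rightarrow> 'a tape" where
  "input_tape w = (0, \<lambda>i. if 0 \<le> i \<and> i < int (length w) then Inp (w ! nat i) else Blank)"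

definition init :: "'a tm \<Rightarrow> 'a list \<Rightarrow> 'a config" where
  "init M w = (start M, input_tape w # replicate (ntapes M - 1) (input_tape []))"

definition decides_in_time ::
    "'a set \<Rightarrow> 'a tm \<Rightarrow> 'a list set \<Rightarrow> (nat \<Rightarrow> nat) \<Rightarrow> bool" where
  "decides_in_time \<Sigma> M L T \<longleftrightarrow>
     (\<forall>w\<in>lists \<Sigma>. \<exists>t\<le>T (length w).
        fst ((step M ^^ t) (init M w)) = (if w \<in> L then accept M else reject M))"

definition polytime_decidable :: "'a set \<Rightarrow> 'a list set \<Rightarrow> bool" where
  "polytime_decidable \<Sigma> L \<longleftrightarrow>
     (\<exists>M. turing_machine \<Sigma> M \<and> (\<exists>P :: nat poly. decides_in_time \<Sigma> M L (poly P)))"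

end

theory Submission
  imports Defs "HOL-Library.Countable_Set"
begin

text \<open>Since \<open>Atm0\<close> and \<open>Val\<close> are finite, there are only finitely many pointed models, so the
  set of pointed models satisfying a formula ranges over a finite algebra and is computed
  compositionally. A formula in Polish notation can therefore be evaluated in linear time by
  reading it from right to left and keeping the values of the subformulas read so far on a stack,
  which is the second tape of a Turing machine.\<close>

section \<open>Evaluating prefix terms over a finite algebra\<close>

text \<open>The head of the list is the top of the stack and hence the leftmost argument.\<close>

definition reduce :: "('a \<Rightarrow> nat) \<Rightarrow> ('a \<Rightarrow> 'd list \<Rightarrow> 'd) \<Rightarrow> 'a \<Rightarrow> 'd list option \<Rightarrow> 'd list option" where
  "reduce ar opr x s = (case s of None \<Rightarrow> None
     | Some st \<Rightarrow> if ar x \<le> length st then Some (opr x (take (ar x) st) # drop (ar x) st) else None)"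

text \<open>\<open>None\<close> marks a stack underflow; a longer final stack means that the word is
  a sequence of several terms. Both count as rejection.\<close>

definition evaluates_into ::
    "('a \<Rightarrow> nat) \<Rightarrow> ('a \<Rightarrow> 'd list \<Rightarrow> 'd) \<Rightarrow> 'd set \<Rightarrow> 'a list \<Rightarrow> 'd list \<Rightarrow> bool" where
  "evaluates_into ar opr F w st \<longleftrightarrow> (\<exists>d\<in>F. foldr (reduce ar opr) w (Some st) = Some [d])"

lemma foldr_reduce_None: "foldr (reduce ar opr) w None = None"
  by (induction w) (auto simp: reduce_def)

text \<open>\<open>Args ds\<close>: the arguments \<open>ds\<close> of the current letter have been popped;
  \<open>Push d\<close>: the stack head is on the free cell that is to receive \<open>d\<close>;
  \<open>Final\<close>: an accepting value has been popped, and the stack must now be empty.\<close>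

datatype ctl = Scan | Args "nat list" | Push nat | Final | Acc | Rej

instance ctl :: countable
  by countable_datatype

text \<open>The bound \<open>K\<close> keeps the control states \<open>Args ds\<close> finite in
  number. Closure of \<open>opr\<close> in \<open>D\<close> is assumed for argument lists of any
  length, so no invariant about the popped lists is needed.\<close>

locale prefix_algebra =
  fixes \<Sigma> :: "'a set" and ar :: "'a \<Rightarrow> nat" and opr :: "'a \<Rightarrow> nat list \<Rightarrow> nat"
    and D F :: "nat set" and K :: nat
  assumes finite_letters: "finite \<Sigma>" and finite_D: "finite D"
    and opr_in_D: "\<And>x ds. opr x ds \<in> D"
    and arity_le: "\<And>x. ar x \<le> K"
begin

text \<open>The result lists the new control state, the move on the input tape, the symbol written
  on the stack tape and the move there. A blank under the stack head while popping signals an empty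
  stack.\<close>

fun ctl_step :: "ctl \<Rightarrow> 'a tape_sym \<Rightarrow> 'a tape_sym \<Rightarrow> ctl \<times> move \<times> 'a tape_sym \<times> move" where
  "ctl_step Scan (Inp x) y = (Scan, Right, y, Stay)"
| "ctl_step Scan _ y = (Args [], Left, y, Stay)"
| "ctl_step (Args ds) (Inp x) y =
     (if ar x \<le> length ds then (Push (opr x ds), Stay, y, Right)
      else case y of Aux d \<Rightarrow> (Args (ds @ [d]), Stay, Blank, Left) | _ \<Rightarrow> (Rej, Stay, y, Stay))"
| "ctl_step (Args ds) _ y =
     (case y of Aux d \<Rightarrow> (if d \<in> F then Final else Rej, Stay, Blank, Left)
      | _ \<Rightarrow> (Rej, Stay, y, Stay))"
| "ctl_step (Push d) _ y = (Args [], Left, Aux d, Stay)"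
| "ctl_step Final _ y = (if y = Blank then Acc else Rej, Stay, y, Stay)"
| "ctl_step q _ y = (q, Stay, y, Stay)"

definition ctls :: "ctl set" where
  "ctls = {Scan, Final, Acc, Rej} \<union> Push ` D \<union> Args ` {ds. set ds \<subseteq> D \<and> length ds \<le> K}"

definition machine :: "'a tm" where
  "machine = \<lparr>ntapes = 2, states = to_nat ` ctls, tape_syms = insert Blank (Inp ` \<Sigma> \<union> Aux ` D),
     start = to_nat Scan, accept = to_nat Acc, reject = to_nat Rej,
     delta = (\<lambda>q rs. let (q', m, y, m') = ctl_step (from_nat q) (rs ! 0) (rs ! 1)
                    in (to_nat q', [(rs ! 0, m), (y, m')]))\<rparr>"

lemma ctl_step_closed:
  assumes "q \<in> ctls" "x \<in> insert Blank (Inp ` \<Sigma> \<union> Aux ` D)"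
    and "y \<in> insert Blank (Inp ` \<Sigma> \<union> Aux ` D)" "ctl_step q x y = (q', m, y', m')"
  shows "q' \<in> ctls \<and> y' \<in> insert Blank (Inp ` \<Sigma> \<union> Aux ` D)"
proof -
  \<comment> \<open>A further value is popped only while fewer than \<open>ar z\<close> are held, so
    the lists in \<open>Args\<close> never outgrow \<open>K\<close>.\<close>
  have "Suc (length ds) \<le> K" if "\<not> ar z \<le> length ds" for z and ds :: "nat list"
    using that arity_le[of z] by linarith
  with assms show ?thesis
    by (cases "(q, x, y)" rule: ctl_step.cases)
      (auto simp: ctls_def opr_in_D split: if_splits tape_sym.splits)
qed

lemma turing_machine_machine: "turing_machine \<Sigma> machine"
proof -
  have "finite ctls"
    unfolding ctls_def using finite_D by (simp add: finite_lists_length_le)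
  moreover have "fst (delta machine q rs) \<in> states machine \<and>
      length (snd (delta machine q rs)) = ntapes machine \<and>
      fst ` set (snd (delta machine q rs)) \<subseteq> tape_syms machine"
    if q: "q \<in> states machine" and rs: "rs \<in> lists (tape_syms machine)" "length rs = ntapes machine"
    for q rs
  proof -
    obtain c where c: "q = to_nat c" "c \<in> ctls" using q by (auto simp: machine_def)
    obtain x y where xy: "rs = [x, y]" "x \<in> tape_syms machine" "y \<in> tape_syms machine"
      using rs by (auto simp: machine_def length_Suc_conv numeral_2_eq_2)
    obtain q' m y' m' where e: "ctl_step c x y = (q', m, y', m')"
      by (cases "ctl_step c x y")
    show ?thesis
      using ctl_step_closed[OF c(2) _ _ e] xy c e by (auto simp: machine_def)
  qed
  ultimately show ?thesis
    unfolding turing_machine_def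
    by (auto simp: machine_def finite_letters finite_D ctls_def)
qed

section \<open>Configurations and runs of the machine\<close>

primrec stack :: "nat list \<Rightarrow> int \<Rightarrow> 'a tape_sym" where
  "stack [] = (\<lambda>_. Blank)"
| "stack (d # st) = (stack st)(int (length st) + 1 := Aux d)"

lemma stack_Blank: "i > int (length st) \<or> i \<le> 0 \<Longrightarrow> stack st i = Blank"
  by (induction st) auto

lemma stack_pop: "(stack (d # st))(int (length st) + 1 := Blank) = stack st"
  using stack_Blank[of st "int (length st) + 1"] by auto

text \<open>The bottom of the stack is in cell 1 and the head rests on the top element; for the
  empty stack it rests on cell 0, which stays blank. The contents of the input tape never
  change.\<close>

definition conf :: "'a list \<Rightarrow> ctl \<Rightarrow> int \<Rightarrow> nat list \<Rightarrow> 'a config" where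
  "conf w q i st = (to_nat q, [(i, snd (input_tape w)), (int (length st), stack st)])"

lemma step_machine:
  assumes "ctl_step q (X i) (Y j) = (q', m, y, m')" "q \<noteq> Acc" "q \<noteq> Rej"
  shows "step machine (to_nat q, [(i, X), (j, Y)])
     = (to_nat q', [(i + shift m, X), (j + shift m', Y(j := y))])"
  using assms by (simp add: step_def machine_def read_def act_def)

lemma input_at: "i < length w \<Longrightarrow> snd (input_tape w) (int i) = Inp (w ! i)"
  by (simp add: input_tape_def)

lemma input_outside: "i < 0 \<or> i \<ge> int (length w) \<Longrightarrow> snd (input_tape w) i = Blank"
  by (auto simp: input_tape_def)

lemma scan_to_end:
  "n \<le> length w \<Longrightarrow> (step machine ^^ n) (init machine w) = conf w Scan (int n) []"
proof (induction n)
  case 0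
  then show ?case
    by (simp add: init_def conf_def input_tape_def machine_def fun_eq_iff)
next
  case (Suc n)
  then have "ctl_step Scan (snd (input_tape w) (int n)) (stack [] 0) = (Scan, Right, Blank, Stay)"
    by (simp add: input_at)
  with Suc show ?case
    by (simp add: conf_def step_machine fun_eq_iff add.commute)
qed

lemma step_conf:
  assumes "ctl_step q (snd (input_tape w) i) (stack st (int (length st))) = (q', m, y, m')"
    and "q \<noteq> Acc" "q \<noteq> Rej" "(stack st)(int (length st) := y) = stack st'"
    and "int (length st) + shift m' = int (length st')" "i + shift m = i'"
  shows "step machine (conf w q i st) = conf w q' i' st'"
  using step_machine[of q "snd (input_tape w)" i "stack st" "int (length st)"] assms
  by (simp add: conf_def)

lemma end_of_scan:
  "(step machine ^^ Suc (length w)) (init machine w) = conf w (Args []) (int (length w) - 1) []"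
proof -
  \<comment> \<open>The extra step reads the blank behind the input and turns back onto the last
    letter.\<close>
  have "step machine (conf w Scan (int (length w)) []) = conf w (Args []) (int (length w) - 1) []"
    by (rule step_conf[where m = Left and m' = Stay and y = Blank])
      (auto simp: input_outside)
  then show ?thesis by (simp add: scan_to_end)
qed

text \<open>The bound \<open>ar x\<close> keeps the machine in its popping branch throughout. Popped
  values are appended at the end of \<open>ds\<close>, so the arguments keep their order from left
  to right.\<close>

lemma pop_args:
  assumes "snd (input_tape w) i = Inp x" "length ds + k \<le> ar x" "k \<le> length st"
  shows "(step machine ^^ k) (conf w (Args ds) i st) = conf w (Args (ds @ take k st)) i (drop k st)"
  using assms
proof (induction k arbitrary: ds st)
  case (Suc k)
  obtain d st' where st: "st = d # st'" using Suc.prems(3) by (cases st) auto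
  have "step machine (conf w (Args ds) i st) = conf w (Args (ds @ [d])) i st'"
  proof (rule step_conf[where m = Stay and m' = Left and y = Blank])
    show "(stack st)(int (length st) := Blank) = stack st'"
      using stack_pop[of d st'] unfolding st by (simp add: add.commute)
  qed (use Suc.prems st in auto)
  moreover have "(step machine ^^ k) (conf w (Args (ds @ [d])) i st') =
      conf w (Args ((ds @ [d]) @ take k st')) i (drop k st')"
    using Suc.prems st by (intro Suc.IH) auto
  ultimately show ?case by (simp only: funpow_Suc_right o_apply) (simp add: st)
qed simp

lemma push_result:
  assumes "snd (input_tape w) i = Inp x" "length ds = ar x"
  shows "(step machine ^^ 2) (conf w (Args ds) i st) = conf w (Args []) (i - 1) (opr x ds # st)"
proof -
  \<comment> \<open>Here the stack head stands one cell above the top, so this configuration is not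
    a \<open>conf\<close> and \<open>step_machine\<close> is applied directly.\<close>
  have "step machine (conf w (Args ds) i st) =
      (to_nat (Push (opr x ds)), [(i, snd (input_tape w)), (int (length st) + 1, stack st)])"
    unfolding conf_def
    by (subst step_machine[where q' = "Push (opr x ds)" and m = Stay and m' = Right
          and y = "stack st (int (length st))"])
      (use assms in auto)
  moreover have "step machine \<dots> = conf w (Args []) (i - 1) (opr x ds # st)"
    unfolding conf_def
    by (subst step_machine[where q' = "Args []" and m = Left and m' = Stay and y = "Aux (opr x ds)"])
      auto
  ultimately show ?thesis by (simp add: numeral_2_eq_2)
qed

section \<open>Halting times and acceptance\<close>

definition halts_within :: "'a config \<Rightarrow> nat \<Rightarrow> bool \<Rightarrow> bool" where
  "halts_within c n b \<longleftrightarrow>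
     (\<exists>t\<le>n. fst ((step machine ^^ t) c) = (if b then accept machine else reject machine))"

lemma halts_within_steps:
  assumes "(step machine ^^ k) c = c'" "halts_within c' n b" "k + n \<le> m"
  shows "halts_within c m b"
proof -
  obtain t where t: "t \<le> n" "fst ((step machine ^^ t) c') = (if b then accept machine else reject machine)"
    using assms(2) unfolding halts_within_def by blast
  have "(step machine ^^ (t + k)) c = (step machine ^^ t) c'"
    using assms(1) by (simp add: funpow_add)
  with t assms(3) show ?thesis
    unfolding halts_within_def by (intro exI[of _ "t + k"]) simp
qed

lemma halts_within_halted: "halts_within (conf w (if b then Acc else Rej) i st) n b"
  unfolding halts_within_def by (intro exI[of _ 0]) (simp add: conf_def machine_def)

lemma halts_within_step:
  assumes "step machine c = conf w (if b then Acc else Rej) i st"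
  shows "halts_within c 1 b"
  using assms by (auto intro: halts_within_steps[OF _ halts_within_halted[of w b i st 0], of 1])

lemma reject_underflow:
  assumes "snd (input_tape w) i = Inp x" "length ds < ar x"
  shows "halts_within (conf w (Args ds) i []) 1 False"
  by (rule halts_within_step, rule step_conf[where m = Stay and m' = Stay and y = Blank and st' = "[]"])
    (use assms in auto)

text \<open>Cell -1 is the blank to the left of the input. One step pops the top and tests it
  against \<open>F\<close>, a second tests that nothing lies below.\<close>

lemma halts_at_left_end: "halts_within (conf w (Args []) (-1) st) 2 (\<exists>d\<in>F. st = [d])"
proof (cases st)
  case Nil
  have "step machine (conf w (Args []) (-1) []) = conf w Rej (-1) []"
    by (rule step_conf[where m = Stay and m' = Stay and y = Blank]) (auto simp: input_outside)
  with Nil show ?thesis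
    using halts_within_steps[OF _ halts_within_halted[of w False "-1" "[]" 1], of 1] by simp
next
  case (Cons d st')
  have 1: "step machine (conf w (Args []) (-1) st) = conf w (if d \<in> F then Final else Rej) (-1) st'"
  proof (rule step_conf[where m = Stay and m' = Left and y = Blank])
    show "(stack st)(int (length st) := Blank) = stack st'"
      using stack_pop[of d st'] unfolding Cons by (simp add: add.commute)
  qed (auto simp: input_outside Cons)
  show ?thesis
  proof (cases "d \<in> F")
    case False
    with 1 Cons show ?thesis
      using halts_within_steps[OF _ halts_within_halted[of w False "-1" st' 1], of 1] by auto
  next
    case True
    have "step machine (conf w Final (-1) st') = conf w (if st' = [] then Acc else Rej) (-1) st'"
      by (rule step_conf[where m = Stay and m' = Stay and y = "stack st' (int (length st'))"])
        (auto simp: neq_Nil_conv)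
    then have "halts_within (conf w Final (-1) st') 1 (st' = [])"
      by (rule halts_within_step)
    moreover have "(\<exists>d\<in>F. st = [d]) \<longleftrightarrow> st' = []"
      using True Cons by auto
    ultimately show ?thesis
      using 1 True halts_within_steps[of 1 "conf w (Args []) (-1) st" "conf w Final (-1) st'" 1]
      by simp
  qed
qed

text \<open>Induction on the unread prefix \<open>u\<close>, with the read suffix \<open>v\<close>
  and the stack arbitrary. A letter costs at most \<open>K\<close> pops and two steps to push; the
  last two steps are those at the left end.\<close>

lemma evaluates_prefix:
  "halts_within (conf (u @ v) (Args []) (int (length u) - 1) st) ((K + 2) * length u + 2)
     (evaluates_into ar opr F u st)"
proof (induction u arbitrary: v st rule: rev_induct)
  case Nil
  then show ?case
    using halts_at_left_end[of v st] by (simp add: evaluates_into_def numeral_2_eq_2)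
next
  case (snoc x u)
  let ?w = "(u @ [x]) @ v" and ?i = "int (length (u @ [x])) - 1"
  have x: "snd (input_tape ?w) ?i = Inp x"
    using input_at[of "length u" ?w] by (simp add: nth_append)
  show ?case
  proof (cases "ar x \<le> length st")
    case True
    let ?st = "opr x (take (ar x) st) # drop (ar x) st"
    have "(step machine ^^ (2 + ar x)) (conf ?w (Args []) ?i st) = conf ?w (Args []) (?i - 1) ?st"
      using pop_args[OF x, of "[]" "ar x" st] push_result[OF x, of "take (ar x) st" "drop (ar x) st"] True
      by (simp only: funpow_add o_apply) simp
    moreover have "halts_within (conf ?w (Args []) (?i - 1) ?st) ((K + 2) * length u + 2)
        (evaluates_into ar opr F u ?st)"
      using snoc[of "x # v" ?st] by simp
    moreover have "evaluates_into ar opr F (u @ [x]) st = evaluates_into ar opr F u ?st"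
      using True by (simp add: evaluates_into_def reduce_def)
    moreover have "2 + ar x + ((K + 2) * length u + 2) \<le> (K + 2) * length (u @ [x]) + 2"
      using arity_le[of x] by simp
    ultimately show ?thesis
      by (simp only:) (rule halts_within_steps)
  next
    case False
    \<comment> \<open>On underflow the machine first pops everything that is left and then meets the
      blank in cell 0.\<close>
    then have "(step machine ^^ length st) (conf ?w (Args []) ?i st) = conf ?w (Args st) ?i []"
      by (subst pop_args[OF x]) auto
    moreover have "halts_within (conf ?w (Args st) ?i []) 1 False"
      using reject_underflow[OF x] False by simp
    moreover have "\<not> evaluates_into ar opr F (u @ [x]) st"
      using False by (simp add: evaluates_into_def reduce_def foldr_reduce_None)
    moreover have "length st + 1 \<le> (K + 2) * length (u @ [x]) + 2"
      using arity_le[of x] False by simp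
    ultimately show ?thesis
      by (simp only:) (rule halts_within_steps)
  qed
qed

theorem polytime_decidable_evaluation:
  assumes L: "\<And>w. w \<in> lists \<Sigma> \<Longrightarrow> w \<in> L \<longleftrightarrow> evaluates_into ar opr F w []"
  shows "polytime_decidable \<Sigma> L"
proof -
  \<comment> \<open>For length n: n + 1 steps of scanning and (K + 2) * n + 2 of evaluation.\<close>
  have "decides_in_time \<Sigma> machine L (poly [:3, K + 3:])"
    unfolding decides_in_time_def
  proof
    fix w assume w: "w \<in> lists \<Sigma>"
    have "halts_within (init machine w) (poly [:3, K + 3:] (length w)) (evaluates_into ar opr F w [])"
    proof (rule halts_within_steps[OF end_of_scan])
      show "halts_within (conf w (Args []) (int (length w) - 1) []) ((K + 2) * length w + 2)
          (evaluates_into ar opr F w [])"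
        using evaluates_prefix[of w "[]" "[]"] by simp
    qed (simp add: algebra_simps)
    then show "\<exists>t\<le>poly [:3, K + 3:] (length w). fst ((step machine ^^ t) (init machine w)) =
        (if w \<in> L then accept machine else reject machine)"
      unfolding halts_within_def L[OF w] .
  qed
  with turing_machine_machine show ?thesis
    unfolding polytime_decidable_def by blast
qed

end

section \<open>The algebra of truth sets\<close>

definition pointed_models :: "'p set \<Rightarrow> 'v set \<Rightarrow> (('p, 'v) model \<times> 'p set \<times> ('p, 'v) classifier) set" where
  "pointed_models Atm0 Val = {(\<Gamma>, s, f). \<Gamma> \<in> MCM Atm0 Val \<and> s \<in> fst \<Gamma> \<and> f \<in> snd \<Gamma>}"

lemma finite_pointed_models:
  fixes Atm0 :: "'p set" and Val :: "'v set"
  assumes "finite Atm0" "finite Val"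
  shows "finite (pointed_models Atm0 Val)"
proof -
  \<comment> \<open>The domain of a classifier varies with the model, so the finite function spaces
    over all possible domains are collected.\<close>
  let ?C = "\<Union>S\<in>Pow (Pow Atm0). S \<rightarrow>\<^sub>E Val"
  have "finite ?C"
    using assms by (auto intro!: finite_PiE intro: finite_subset)
  then have "finite ((Pow (Pow Atm0) \<times> Pow ?C) \<times> Pow Atm0 \<times> ?C)"
    using assms by blast
  moreover have "pointed_models Atm0 Val \<subseteq> (Pow (Pow Atm0) \<times> Pow ?C) \<times> Pow Atm0 \<times> ?C"
  proof
    fix x assume "x \<in> pointed_models Atm0 Val"
    then obtain S \<Phi> s f where x: "x = ((S, \<Phi>), s, f)"
      and S: "S \<in> Pow (Pow Atm0)" and \<Phi>: "\<Phi> \<subseteq> S \<rightarrow>\<^sub>E Val" and "s \<in> S" "f \<in> \<Phi>"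
      by (auto simp: pointed_models_def MCM_def)
    moreover have "\<Phi> \<subseteq> ?C"
      using \<Phi> UN_upper[OF S, of "\<lambda>S. S \<rightarrow>\<^sub>E Val"] by (rule subset_trans)
    moreover from this \<open>f \<in> \<Phi>\<close> have "f \<in> ?C" by (rule subsetD)
    moreover have "s \<in> Pow Atm0" using S \<open>s \<in> S\<close> by blast
    ultimately show "x \<in> (Pow (Pow Atm0) \<times> Pow ?C) \<times> Pow Atm0 \<times> ?C"
      using S unfolding x mem_Times_iff fst_conv snd_conv by (intro conjI PowI) simp_all
  qed
  ultimately show ?thesis by (rule rev_finite_subset)
qed

definition truth :: "'p set \<Rightarrow> 'v set \<Rightarrow> ('p, 'v) fm \<Rightarrow> (('p, 'v) model \<times> 'p set \<times> ('p, 'v) classifier) set" where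
  "truth Atm0 Val \<phi> = {(\<Gamma>, s, f) \<in> pointed_models Atm0 Val. holds \<Gamma> s f \<phi>}"

primrec arity :: "('p, 'v) letter \<Rightarrow> nat" where
  "arity (LProp p) = 0"
| "arity (LDec x) = 0"
| "arity LNeg = 1"
| "arity LConj = 2"
| "arity LBoxI = 1"
| "arity LBoxF = 1"

text \<open>Every clause is cut down to \<open>pointed_models\<close>, so the value lies in the
  finite power set even for ill-formed argument lists, where \<open>As ! 0\<close> may be
  arbitrary.\<close>

primrec truth_op :: "'p set \<Rightarrow> 'v set \<Rightarrow> ('p, 'v) letter
    \<Rightarrow> (('p, 'v) model \<times> 'p set \<times> ('p, 'v) classifier) set list
    \<Rightarrow> (('p, 'v) model \<times> 'p set \<times> ('p, 'v) classifier) set" where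
  "truth_op Atm0 Val (LProp p) As = {(\<Gamma>, s, f) \<in> pointed_models Atm0 Val. p \<in> s}"
| "truth_op Atm0 Val (LDec x) As = {(\<Gamma>, s, f) \<in> pointed_models Atm0 Val. f s = x}"
| "truth_op Atm0 Val LNeg As = pointed_models Atm0 Val - As ! 0"
| "truth_op Atm0 Val LConj As = pointed_models Atm0 Val \<inter> As ! 0 \<inter> As ! 1"
| "truth_op Atm0 Val LBoxI As =
     {(\<Gamma>, s, f) \<in> pointed_models Atm0 Val. \<forall>s'\<in>fst \<Gamma>. (\<Gamma>, s', f) \<in> As ! 0}"
| "truth_op Atm0 Val LBoxF As =
     {(\<Gamma>, s, f) \<in> pointed_models Atm0 Val. \<forall>f'\<in>snd \<Gamma>. (\<Gamma>, s, f') \<in> As ! 0}"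

lemma truth_op_subset: "truth_op Atm0 Val x As \<subseteq> pointed_models Atm0 Val"
  by (cases x) auto

text \<open>A box moves only \<open>s\<close> or only \<open>f\<close> within the same model and so
  ends in a pointed model again; hence the truth set of the argument determines that of the boxed
  formula.\<close>

lemma truth_simps:
  "truth Atm0 Val (Prop p) = truth_op Atm0 Val (LProp p) []"
  "truth Atm0 Val (Dec x) = truth_op Atm0 Val (LDec x) []"
  "truth Atm0 Val (Neg \<phi>) = truth_op Atm0 Val LNeg [truth Atm0 Val \<phi>]"
  "truth Atm0 Val (Conj \<phi> \<psi>) = truth_op Atm0 Val LConj [truth Atm0 Val \<phi>, truth Atm0 Val \<psi>]"
  "truth Atm0 Val (BoxI \<phi>) = truth_op Atm0 Val LBoxI [truth Atm0 Val \<phi>]"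
  "truth Atm0 Val (BoxF \<phi>) = truth_op Atm0 Val LBoxF [truth Atm0 Val \<phi>]"
  by (auto simp: truth_def pointed_models_def)

lemma satisfiable_iff_truth: "satisfiable Atm0 Val \<phi> \<longleftrightarrow> truth Atm0 Val \<phi> \<noteq> {}"
  unfolding satisfiable_def truth_def pointed_models_def by blast

section \<open>Evaluating formulas in Polish notation\<close>

lemma formulas_if_polish_in_lists:
  "polish \<phi> \<in> lists (letters Atm0 Val) \<Longrightarrow> \<phi> \<in> formulas Atm0 Val"
  by (induction \<phi>) (auto simp: formulas_def letters_def)

text \<open>The assumptions say that \<open>val\<close> is a homomorphism from the term algebra of
  formulas; \<open>opr\<close> is constrained only on values of formulas.\<close>

locale formula_algebra =
  fixes opr :: "('p, 'v) letter \<Rightarrow> 'd list \<Rightarrow> 'd" and val :: "('p, 'v) fm \<Rightarrow> 'd"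
  assumes opr_val:
    "opr (LProp p) [] = val (Prop p)" "opr (LDec x) [] = val (Dec x)"
    "opr LNeg [val \<phi>] = val (Neg \<phi>)" "opr LConj [val \<phi>, val \<psi>] = val (Conj \<phi> \<psi>)"
    "opr LBoxI [val \<phi>] = val (BoxI \<phi>)" "opr LBoxF [val \<phi>] = val (BoxF \<phi>)"
begin

lemma foldr_reduce_polish:
  "foldr (reduce arity opr) (polish \<phi>) (Some st) = Some (val \<phi> # st)"
  by (induction \<phi> arbitrary: st) (auto simp: reduce_def opr_val)

text \<open>A suffix of a Polish word is in general a sequence of formulas, so the induction needs
  lists. Thus evaluation without underflow is itself a parse, and no separate syntax check is
  required.\<close>

lemma foldr_reduce_Some_imp_polish:
  "foldr (reduce arity opr) w (Some []) = Some st \<Longrightarrow>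
     \<exists>\<phi>s. w = concat (map polish \<phi>s) \<and> st = map val \<phi>s"
proof (induction w arbitrary: st)
  case Nil
  then show ?case by (intro exI[of _ "[]"]) auto
next
  case (Cons x w)
  then obtain st' where st': "foldr (reduce arity opr) w (Some []) = Some st'"
    and st: "arity x \<le> length st'" "st = opr x (take (arity x) st') # drop (arity x) st'"
    unfolding foldr.simps o_apply reduce_def[of _ _ x]
    by (cases "foldr (reduce arity opr) w (Some [])") (auto split: if_splits)
  from Cons.IH[OF st'] obtain \<phi>s where \<phi>s: "w = concat (map polish \<phi>s)" "st' = map val \<phi>s"
    by blast
  \<comment> \<open>The letter \<open>x\<close> takes the first \<open>arity x\<close> formulas as
    arguments of a new formula; the others remain as \<open>\<psi>s\<close>.\<close>
  have "\<exists>\<phi> \<psi>s. x # w = polish \<phi> @ concat (map polish \<psi>s) \<and> st = val \<phi> # map val \<psi>s"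
  proof (cases x)
    case (LProp p)
    with \<phi>s st show ?thesis by (intro exI[of _ "Prop p"] exI[of _ \<phi>s]) (auto simp: opr_val)
  next
    case (LDec y)
    with \<phi>s st show ?thesis by (intro exI[of _ "Dec y"] exI[of _ \<phi>s]) (auto simp: opr_val)
  next
    case LNeg
    with \<phi>s st obtain \<phi> \<psi>s where "\<phi>s = \<phi> # \<psi>s" by (cases \<phi>s) auto
    with LNeg \<phi>s st show ?thesis by (intro exI[of _ "Neg \<phi>"] exI[of _ \<psi>s]) (auto simp: opr_val)
  next
    case LConj
    with \<phi>s st obtain \<phi> \<phi>' \<psi>s where "\<phi>s = \<phi> # \<phi>' # \<psi>s"
      by (cases \<phi>s; cases "tl \<phi>s") auto
    with LConj \<phi>s st show ?thesis
      by (intro exI[of _ "Conj \<phi> \<phi>'"] exI[of _ \<psi>s]) (auto simp: opr_val)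
  next
    case LBoxI
    with \<phi>s st obtain \<phi> \<psi>s where "\<phi>s = \<phi> # \<psi>s" by (cases \<phi>s) auto
    with LBoxI \<phi>s st show ?thesis by (intro exI[of _ "BoxI \<phi>"] exI[of _ \<psi>s]) (auto simp: opr_val)
  next
    case LBoxF
    with \<phi>s st obtain \<phi> \<psi>s where "\<phi>s = \<phi> # \<psi>s" by (cases \<phi>s) auto
    with LBoxF \<phi>s st show ?thesis by (intro exI[of _ "BoxF \<phi>"] exI[of _ \<psi>s]) (auto simp: opr_val)
  qed
  then obtain \<phi> \<psi>s where "x # w = concat (map polish (\<phi> # \<psi>s))" "st = map val (\<phi> # \<psi>s)"
    by auto
  then show ?case by blast
qed

lemma evaluates_into_iff_polish:
  "evaluates_into arity opr F w [] \<longleftrightarrow> (\<exists>\<phi>. w = polish \<phi> \<and> val \<phi> \<in> F)"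
  unfolding evaluates_into_def
  by (auto simp: foldr_reduce_polish dest!: foldr_reduce_Some_imp_polish)

end

theorem theorem6:
  fixes Atm0 :: "'p set" and Val :: "'v set"
  assumes "finite Atm0" and "finite Val"
  shows "polytime_decidable (letters Atm0 Val) (SAT Atm0 Val)"
proof -
  \<comment> \<open>\<open>D\<close> depends on \<open>Atm0\<close> and \<open>Val\<close> alone:
    its size affects the machine but not the degree or coefficients of the time bound.\<close>
  define D where "D = Pow (pointed_models Atm0 Val)"
  \<comment> \<open>Auxiliary tape symbols carry natural numbers, so truth sets are put on the stack
    as codes.\<close>
  define enc where "enc = to_nat_on D"
  define opr where "opr x ns = enc (truth_op Atm0 Val x (map (from_nat_into D) ns))" for x ns
  have fin: "finite D" using finite_pointed_models[OF assms] by (simp add: D_def)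
  have truth_D: "truth Atm0 Val \<phi> \<in> D" for \<phi>
    by (auto simp: D_def truth_def)
  have dec: "from_nat_into D (enc A) = A" if "A \<in> D" for A
    using that fin by (simp add: enc_def countable_finite)
  \<comment> \<open>The accepting values are the codes of nonempty truth sets; 2 is the arity of
    conjunction.\<close>
  interpret prefix_algebra "letters Atm0 Val" arity opr "enc ` D" "enc ` (D - {{}})" 2
  proof
    show "finite (letters Atm0 Val)" using assms by (simp add: letters_def)
    show "finite (enc ` D)" using fin by simp
    show "opr x ds \<in> enc ` D" for x ds
      unfolding opr_def D_def by (intro imageI PowI truth_op_subset)
    show "arity x \<le> 2" for x :: "('p, 'v) letter" by (cases x) auto
  qed
  interpret formula_algebra opr "\<lambda>\<phi>. enc (truth Atm0 Val \<phi>)"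
    by standard (auto simp: opr_def dec truth_D truth_simps simp del: truth_op.simps)
  \<comment> \<open>Since \<open>enc\<close> is injective on \<open>D\<close>, the code of the empty
    set is not shared by a nonempty truth set.\<close>
  have "enc (truth Atm0 Val \<phi>) \<in> enc ` (D - {{}}) \<longleftrightarrow> satisfiable Atm0 Val \<phi>" for \<phi>
    unfolding satisfiable_iff_truth
    using inj_on_image_mem_iff[OF inj_on_inverseI[of D "from_nat_into D" enc, OF dec] truth_D]
    by (simp add: truth_D)
  then show ?thesis
    by (intro polytime_decidable_evaluation)
      (auto simp: evaluates_into_iff_polish SAT_def intro: formulas_if_polish_in_lists)
qed

end
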